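(* There is an absolute constant $C$ such that for every $n\ge 2$, any family $\mathcal{F}$ of $n$ closed discs in the plane (discs of radius $0$, i.e. points, allowed) can be colored with at most $C\log n$ colors so that for every closed disc $B$ in the plane (not necessarily in $\mathcal{F}$) for which $S_B=\{D\in\mathcal{F}: D\cap B\ne\emptyset\}$ is nonempty, $S_B$ contains an element whose color differs from the colors of all other elements of $S_B$. This bound is asymptotically tight: there is an absolute constant $c>0$ such that for every $n\ge 2$ there is a family of $n$ discs for which any coloring with this property uses at least $c\log n$ colors. *)

theory Defs
  imports "HOL-Analysis.Analysis"
begin

definition is_disc :: "complex set \<Rightarrow> bool" where
  "is_disc D \<longleftrightarrow> (\<exists>c r. r \<ge> 0 \<and> D = cball c r)"

definition hit_set :: "complex set set \<Rightarrow> complex set \<Rightarrow> complex set set" where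
  "hit_set F B = {D \<in> F. D \<inter> B \<noteq> {}}"

definition cf_coloring :: "complex set set \<Rightarrow> (complex set \<Rightarrow> nat) \<Rightarrow> bool" where
  "cf_coloring F col \<longleftrightarrow>
     (\<forall>B. is_disc B \<longrightarrow> hit_set F B \<noteq> {} \<longrightarrow>
        (\<exists>D\<in>hit_set F B. \<forall>D'\<in>hit_set F B. D' \<noteq> D \<longrightarrow> col D' \<noteq> col D))"

end

(*
  Upper bound. Order the discs at a point x by the signed distance |x - c| - r, breaking ties by an
  index, and join two discs if they come first at some point. A set of discs owns the region of
  points at which one of its members precedes all non-members. Disjoint sets own disjoint regions,
  and two joined discs have their centres joined by two segments inside the region of the pair. So
  a K5 minor would give five points joined by arcs in which arcs without common endpoint are
  disjoint, which winding numbers exclude. By Mader's theorem the graph is sparse, hence has an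
  independent set of at least n/16 discs. These receive one colour, and the rest is coloured
  recursively: if B meets none of the rest, then it meets only one disc, because the first two
  discs at the centre of B are joined.

  Lower bound. For n collinear points every interval needs a uniquely coloured point; removing it
  splits the interval into two that use one colour less, so k colours suffice for at most 2^k - 1
  points.
*)

theory Submission
  imports Defs "HOL-Complex_Analysis.Riemann_Mapping" "HOL-Library.Disjoint_Sets"
begin

section \<open>Winding numbers of open paths, and the nonplanarity of the complete graph on five
  vertices\<close>

text \<open>The difference of the two logarithms takes values in the integer multiples of
  \<open>2 * pi * \<i>\<close>. These are discrete, so it is constant on the connected
  interval.\<close>

lemma continuous_logs_differ_by_constant:
  fixes f g :: "real \<Rightarrow> complex"
  assumes f: "continuous_on {0..1} f" and g: "continuous_on {0..1} g"
    and eq: "\<And>t. t \<in> {0..1} \<Longrightarrow> exp (f t) = exp (g t)"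
  shows "f 1 - f 0 = g 1 - g 0"
proof -
  let ?h = "\<lambda>t. f t - g t"
  have 2: "2 * pi \<le> norm (?h y - ?h x)" if xy: "x \<in> {0..1}" "y \<in> {0..1}" "?h y \<noteq> ?h x" for x y
  proof -
    have "exp (?h y - ?h x) = 1"
      using eq[OF xy(1)] eq[OF xy(2)] by (simp add: exp_diff)
    then obtain n :: int where n: "?h y - ?h x = of_int (2 * n) * pi * \<i>"
      using exp_eq[of "?h y - ?h x" 0] by auto
    with xy(3) have "n \<noteq> 0"
      by auto
    then have "1 \<le> \<bar>real_of_int n\<bar>"
      by linarith
    then show ?thesis
      unfolding n by (simp add: norm_mult)
  qed
  have "?h constant_on {0..1}"
    by (rule continuous_discrete_range_constant)
      (use 2 pi_gt_zero in \<open>auto intro!: continuous_intros f g exI[of _ "2 * pi"]\<close>)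
  then show ?thesis
    unfolding constant_on_def by (metis atLeastAtMost_iff diff_eq_eq diff_add_cancel
      diff_diff_eq2 order_refl zero_le_one add_diff_cancel_left' add.commute)
qed

text \<open>One continuous logarithm of \<open>p - z\<close> has this property by
  \<open>winding_number_as_continuous_log\<close>, and any two have the same total change. The path
  may be open.\<close>

lemma winding_number_eq_log_change:
  assumes p: "path p" and L: "continuous_on {0..1} L"
    and eq: "\<And>t. t \<in> {0..1} \<Longrightarrow> p t - z = exp (L t)"
  shows "2 * of_real pi * \<i> * winding_number p z = L 1 - L 0"
proof -
  have "z \<notin> path_image p"
    using eq unfolding path_image_def by (metis exp_not_eq_zero imageE right_minus_eq)
  with p obtain q where q: "path q"
      "pathfinish q - pathstart q = 2 * of_real pi * \<i> * winding_number p z"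
      "\<And>t. t \<in> {0..1} \<Longrightarrow> p t = z + exp (q t)"
    using winding_number_as_continuous_log by blast
  have "q 1 - q 0 = L 1 - L 0"
    by (rule continuous_logs_differ_by_constant)
      (use q L eq in \<open>auto simp: path_def\<close>)
  with q(2) show ?thesis
    by (simp add: pathfinish_def pathstart_def)
qed

text \<open>The function \<open>p s - q t\<close> has no zero on the unit square, so it has a
  continuous logarithm \<open>L\<close> there. Up to the factor \<open>2 * pi * \<i>\<close>, both
  sides are the same alternating sum of \<open>L\<close> over the four corners.\<close>

lemma winding_number_disjoint_paths:
  assumes p: "path p" and q: "path q" and disj: "path_image p \<inter> path_image q = {}"
  shows "winding_number p (pathstart q) - winding_number p (pathfinish q) =
         winding_number q (pathstart p) - winding_number q (pathfinish p)"
proof -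
  let ?S = "{0..1::real} \<times> {0..1::real}"
  have cp: "continuous_on {0..1} p" and cq: "continuous_on {0..1} q"
    using p q by (auto simp: path_def)
  have "continuous_on ?S (\<lambda>x. p (fst x) - q (snd x))"
    by (intro continuous_on_diff continuous_on_compose2[OF cp] continuous_on_compose2[OF cq]
        continuous_intros) auto
  moreover have "contractible ?S"
    by (intro convex_imp_contractible convex_Times) auto
  moreover have "p (fst x) - q (snd x) \<noteq> 0" if "x \<in> ?S" for x
  proof -
    have "p (fst x) \<in> path_image p" "q (snd x) \<in> path_image q"
      using that by (auto simp: path_image_def)
    with disj show ?thesis
      by auto
  qed
  ultimately obtain L where L: "continuous_on ?S L"
    and eq: "\<And>x. x \<in> ?S \<Longrightarrow> p (fst x) - q (snd x) = exp (L x)"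
    using continuous_logarithm_on_contractible by blast
  have P: "2 * of_real pi * \<i> * winding_number p (q t) = L (1, t) - L (0, t)"
    if t: "t \<in> {0..1}" for t
  proof (rule winding_number_eq_log_change[OF p, where L = "\<lambda>s. L (s, t)"])
    show "continuous_on {0..1} (\<lambda>s. L (s, t))"
      by (rule continuous_on_compose2[OF L]) (use t in \<open>auto intro!: continuous_intros\<close>)
    show "p s - q t = exp (L (s, t))" if "s \<in> {0..1}" for s
      using eq[of "(s, t)"] that t by simp
  qed
  have Q: "2 * of_real pi * \<i> * winding_number q (p s) = L (s, 1) - L (s, 0)"
    if s: "s \<in> {0..1}" for s
  proof -
    \<comment> \<open>Here the difference is \<open>q t - p s\<close>, the negative of what
      \<open>L\<close> describes. Shifting \<open>L\<close> by \<open>\<i> * pi\<close> accounts for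
      the sign and cancels in the change.\<close>
    have "2 * of_real pi * \<i> * winding_number q (p s) =
        (L (s, 1) + \<i> * pi) - (L (s, 0) + \<i> * pi)"
    proof (rule winding_number_eq_log_change[OF q, where L = "\<lambda>t. L (s, t) + \<i> * pi"])
      show "continuous_on {0..1} (\<lambda>t. L (s, t) + \<i> * pi)"
        by (intro continuous_intros continuous_on_compose2[OF L]) (use s in auto)
      show "q t - p s = exp (L (s, t) + \<i> * pi)" if "t \<in> {0..1}" for t
        using eq[of "(s, t)"] that s by (simp add: exp_add flip: minus_diff_eq[of "p s"])
    qed
    then show ?thesis
      by simp
  qed
  have "2 * of_real pi * \<i> * (winding_number p (q 0) - winding_number p (q 1)) =
      2 * of_real pi * \<i> * (winding_number q (p 0) - winding_number q (p 1))"
    unfolding right_diff_distrib using P[of 0] P[of 1] Q[of 0] Q[of 1] by simp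
  then show ?thesis
    by (simp add: pathstart_def pathfinish_def)
qed

lemma exp_winding_number_path:
  assumes "path p" "pathstart p = a" "pathfinish p = b" "z \<notin> path_image p"
  shows "exp (2 * pi * \<i> * winding_number p z) = (b - z) / (a - z)"
proof -
  have "a \<noteq> z"
    using assms by auto
  then show ?thesis
    using winding_number_exp_2pi[of p z] assms by (simp add: field_simps)
qed

text \<open>A closed triangle of three of the paths would have half-integral winding number about a
  fourth vertex: by the identities for all fifteen pairs of disjoint edges, this number equals an
  expression in the three triangle vertices alone, whose exponential is
  \<open>(-1)^3\<close>.\<close>

lemma no_planar_complete_graph_5:
  fixes z :: "nat \<Rightarrow> complex" and g :: "nat \<Rightarrow> nat \<Rightarrow> real \<Rightarrow> complex"
  assumes path: "\<And>i j. i < j \<Longrightarrow> j < 5 \<Longrightarrow> path (g i j) \<and> pathstart (g i j) = z i \<and> pathfinish (g i j) = z j"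
    and disj: "\<And>i j k l. i < j \<Longrightarrow> j < 5 \<Longrightarrow> k < l \<Longrightarrow> l < 5 \<Longrightarrow> {i, j} \<inter> {k, l} = {} \<Longrightarrow>
      path_image (g i j) \<inter> path_image (g k l) = {}"
  shows False
proof -
  define W where "W i j k = winding_number (g i j) (z k)" for i j k
  have W: "W i j k - W i j l = W k l i - W k l j"
    if "i < j" "j < 5" "k < l" "l < 5" "{i, j} \<inter> {k, l} = {}" for i j k l
    using winding_number_disjoint_paths[of "g i j" "g k l"] path[of i j] path[of k l] disj[of i j k l] that
    unfolding W_def by simp
  have ends: "z i \<in> path_image (g i j)" "z j \<in> path_image (g i j)" if "i < j" "j < 5" for i j
    using path[OF that] by (metis pathstart_in_path_image pathfinish_in_path_image)+
  \<comment> \<open>The vertex \<open>l\<close> provides an edge at \<open>k\<close>, in either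
    orientation, that is disjoint from the edge \<open>i j\<close>; this keeps \<open>z k\<close>
    off the path \<open>g i j\<close>.\<close>
  have E: "exp (2 * pi * \<i> * W i j k) = (z j - z k) / (z i - z k)" "z k \<noteq> z i" "z k \<noteq> z j"
    if "i < j" "j < 5" "k < l \<and> l < 5 \<or> l < k \<and> k < 5" "{i, j} \<inter> {k, l} = {}" for i j k l
  proof -
    have "z k \<notin> path_image (g i j)"
      using that(3)
    proof
      assume "k < l \<and> l < 5"
      then show ?thesis
        using disj[of i j k l] ends[of k l] that by auto
    next
      assume "l < k \<and> k < 5"
      then show ?thesis
        using disj[of i j l k] ends[of l k] that by auto
    qed
    then show "exp (2 * pi * \<i> * W i j k) = (z j - z k) / (z i - z k)" "z k \<noteq> z i" "z k \<noteq> z j"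
      using exp_winding_number_path[of "g i j" "z i" "z j" "z k"] path[OF that(1,2)] ends[OF that(1,2)]
      unfolding W_def by auto
  qed
  \<comment> \<open>\<open>X\<close> is the winding number of the closed triangle 0, 1, 4 about
    vertex 2. In \<open>Y\<close> each edge of this triangle is taken about the opposite
    vertex.\<close>
  define X where "X = W 0 1 2 + W 1 4 2 - W 0 4 2"
  define Y where "Y = W 0 1 4 + W 1 4 0 - W 0 4 1"
  have "X = Y"
    unfolding X_def Y_def
    using W[of 0 1 2 3] W[of 0 1 2 4] W[of 0 1 3 4] W[of 0 2 1 3] W[of 0 2 1 4] W[of 0 2 3 4]
      W[of 0 3 1 2] W[of 0 3 1 4] W[of 0 3 2 4] W[of 0 4 1 2] W[of 0 4 1 3] W[of 0 4 2 3]
      W[of 1 2 3 4] W[of 1 3 2 4] W[of 1 4 2 3]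
    \<comment> \<open>Splitting into real and imaginary parts leaves linear arithmetic over the
      reals.\<close>
    by (simp add: complex_eq_iff)
  have "exp (2 * pi * \<i> * X) = 1"
    unfolding X_def ring_distribs exp_add exp_diff
    using E[of 0 1 2 3] E[of 1 4 2 3] E[of 0 4 2 3] by simp
  moreover have "exp (2 * pi * \<i> * Y) = -1"
  proof -
    have "exp (2 * pi * \<i> * Y) =
        (z 1 - z 4) / (z 0 - z 4) * ((z 4 - z 0) / (z 1 - z 0)) / ((z 4 - z 1) / (z 0 - z 1))"
      unfolding Y_def ring_distribs exp_add exp_diff
      using E[of 0 1 4 3] E[of 1 4 0 3] E[of 0 4 1 3] by simp
    \<comment> \<open>Three differences are reversed so that all factors cancel and the three signs
      remain.\<close>
    also have "\<dots> = (z 1 - z 4) / (z 0 - z 4) * ((- (z 0 - z 4)) / (- (z 0 - z 1))) / ((- (z 1 - z 4)) / (z 0 - z 1))"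
      by simp
    also have "\<dots> = -1"
      using E[of 0 1 4 3] E[of 1 4 0 3] E[of 0 4 1 3] by (simp del: minus_diff_eq)
    finally show ?thesis .
  qed
  ultimately show False
    using \<open>X = Y\<close> by simp
qed

section \<open>Complete minors of dense graphs and independent sets of sparse graphs\<close>

definition linked :: "('a \<Rightarrow> 'a \<Rightarrow> bool) \<Rightarrow> 'a set \<Rightarrow> 'a set \<Rightarrow> bool" where
  "linked E A B \<longleftrightarrow> (\<exists>a\<in>A. \<exists>b\<in>B. E a b)"

text \<open>Pairs are ordered, so for symmetric \<open>R\<close> the cardinality is the degree sum,
  twice the number of edges.\<close>

definition arcs :: "('a \<Rightarrow> 'a \<Rightarrow> bool) \<Rightarrow> 'a set \<Rightarrow> ('a \<times> 'a) set" where
  "arcs R P = {(x, y). x \<in> P \<and> y \<in> P \<and> x \<noteq> y \<and> R x y}"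

lemma finite_arcs: "finite P \<Longrightarrow> finite (arcs R P)"
  by (rule finite_subset[of _ "P \<times> P"]) (auto simp: arcs_def)

lemma card_arcs_eq_sum:
  assumes "finite P"
  shows "card (arcs R P) = (\<Sum>x\<in>P. card {y \<in> P. y \<noteq> x \<and> R x y})"
proof -
  have "arcs R P = (SIGMA x:P. {y \<in> P. y \<noteq> x \<and> R x y})"
    by (auto simp: arcs_def)
  then show ?thesis
    using assms by simp
qed

lemma card_arcs_insert:
  assumes "symp R" "finite P" "x \<notin> P"
  shows "card (arcs R (insert x P)) = card (arcs R P) + 2 * card {y \<in> P. R x y}"
proof -
  let ?N = "{y \<in> P. R x y}"
  have "arcs R (insert x P) = arcs R P \<union> (Pair x ` ?N \<union> (\<lambda>y. (y, x)) ` ?N)"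
    using assms(1,3) by (auto simp: arcs_def dest: sympD)
  moreover have "card (Pair x ` ?N \<union> (\<lambda>y. (y, x)) ` ?N) = card ?N + card ?N"
    using assms by (subst card_Un_disjoint) (auto simp: card_image inj_on_def)
  moreover have "arcs R P \<inter> (Pair x ` ?N \<union> (\<lambda>y. (y, x)) ` ?N) = {}"
    using assms(3) by (auto simp: arcs_def)
  ultimately show ?thesis
    using assms(2) by (simp add: card_Un_disjoint finite_arcs)
qed

text \<open>Contracting an edge loses the edge itself and one edge for each common neighbour, where
  two edges become one. Both families are built up from \<open>P - {A, B}\<close> by insertion, and
  the neighbourhoods are compared by inclusion-exclusion.\<close>

lemma card_arcs_contract:
  assumes sym: "symp E" and fin: "finite P" and disj: "disjoint P"
    and AB: "A \<in> P" "B \<in> P" "A \<noteq> B" "linked E A B"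
  shows "card (arcs (linked E) P) = card (arcs (linked E) (insert (A \<union> B) (P - {A, B}))) +
    2 * card {C \<in> P - {A, B}. linked E A C \<and> linked E B C} + 2"
proof -
  let ?R = "P - {A, B}" and ?l = "linked E"
  have syml: "symp ?l"
    using sym by (auto simp: linked_def symp_def)
  have P: "P = insert A (insert B ?R)"
    using AB by auto
  \<comment> \<open>Otherwise it would be disjoint from \<open>A\<close>, which is nonempty because
    it is linked to \<open>B\<close>.\<close>
  have "A \<union> B \<notin> ?R"
  proof
    assume "A \<union> B \<in> ?R"
    then have "(A \<union> B) \<inter> A = {}"
      using disjointD[OF disj, of "A \<union> B" A] AB(1) by blast
    with AB(4) show False
      by (auto simp: linked_def)
  qed
  then have 1: "card (arcs ?l (insert (A \<union> B) ?R)) = card (arcs ?l ?R) + 2 * card {C \<in> ?R. ?l (A \<union> B) C}"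
    using fin by (intro card_arcs_insert syml) auto
  have 2: "card (arcs ?l (insert B ?R)) = card (arcs ?l ?R) + 2 * card {C \<in> ?R. ?l B C}"
    using fin by (intro card_arcs_insert syml) auto
  have "card (arcs ?l P) = card (arcs ?l (insert B ?R)) + 2 * card {C \<in> insert B ?R. ?l A C}"
    by (subst P, rule card_arcs_insert) (use syml fin AB in auto)
  moreover have "{C \<in> insert B ?R. ?l A C} = insert B {C \<in> ?R. ?l A C}"
    using AB by auto
  ultimately have 3: "card (arcs ?l P) = card (arcs ?l (insert B ?R)) + 2 * card {C \<in> ?R. ?l A C} + 2"
    using fin by simp
  have 4: "card {C \<in> ?R. ?l A C} + card {C \<in> ?R. ?l B C} =
      card {C \<in> ?R. ?l (A \<union> B) C} + card {C \<in> ?R. ?l A C \<and> ?l B C}"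
  proof -
    have "{C \<in> ?R. ?l (A \<union> B) C} = {C \<in> ?R. ?l A C} \<union> {C \<in> ?R. ?l B C}"
      "{C \<in> ?R. ?l A C \<and> ?l B C} = {C \<in> ?R. ?l A C} \<inter> {C \<in> ?R. ?l B C}"
      by (auto simp: linked_def)
    then show ?thesis
      using fin card_Un_Int[of "{C \<in> ?R. ?l A C}" "{C \<in> ?R. ?l B C}"] by simp
  qed
  show ?thesis
    using 1 2 3 4 by linarith
qed

text \<open>While some linked pair has fewer than \<open>2 ^ t\<close> common
  neighbours, merging it preserves the density; otherwise the neighbours of any set that has one
  form a family of half the density.\<close>

lemma dense_family_has_complete_minor:
  fixes E :: "'a \<Rightarrow> 'a \<Rightarrow> bool" and conn :: "'a set \<Rightarrow> bool"
  assumes sym: "symp E"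
    and conn_Un: "\<And>A B. conn A \<Longrightarrow> conn B \<Longrightarrow> linked E A B \<Longrightarrow> conn (A \<union> B)"
    and "finite P" "P \<noteq> {}" "disjoint P" "\<And>A. A \<in> P \<Longrightarrow> conn A"
    and "2 ^ t * card P \<le> card (arcs (linked E) P)"
  shows "\<exists>Q. finite Q \<and> card Q = Suc t \<and> disjoint Q \<and> (\<forall>A\<in>Q. conn A) \<and>
    (\<forall>A\<in>Q. \<forall>B\<in>Q. A \<noteq> B \<longrightarrow> linked E A B) \<and> (\<forall>A\<in>Q. \<exists>S\<subseteq>P. S \<noteq> {} \<and> A = \<Union>S)"
  using assms(3-7)
proof (induction t arbitrary: P)
  case 0
  then obtain A where "A \<in> P"
    by auto
  with 0 show ?case
    by (intro exI[of _ "{A}"]) (auto intro!: exI[of _ "{A}"])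
next
  case (Suc t)
  \<comment> \<open>\<open>outer\<close> lowers \<open>t\<close> and serves the passage to a
    neighbourhood; the inner induction on \<open>card P\<close> serves the mergers at fixed
    \<open>t\<close>.\<close>
  note outer = Suc.IH
  show ?case
    using Suc.prems
  proof (induction "card P" arbitrary: P rule: less_induct)
    case less
    let ?l = "linked E"
    have syml: "?l B A" if "?l A B" for A B
      using sym that by (auto simp: linked_def symp_def)
    have "card P > 0"
      using less.prems by (simp add: card_gt_0_iff)
    then have "2 ^ Suc t * card P > 0"
      by simp
    with less.prems(5) have "arcs ?l P \<noteq> {}"
      by (metis card.empty leD)
    then obtain A B where AB: "A \<in> P" "B \<in> P" "A \<noteq> B" "?l A B"
      by (auto simp: arcs_def)
    show ?case
    proof (cases "\<exists>A\<in>P. \<exists>B\<in>P. A \<noteq> B \<and> ?l A B \<and> card {C \<in> P - {A, B}. ?l A C \<and> ?l B C} < 2 ^ t")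
      case True
      then obtain A B where AB: "A \<in> P" "B \<in> P" "A \<noteq> B" "?l A B"
        and few: "card {C \<in> P - {A, B}. ?l A C \<and> ?l B C} < 2 ^ t"
        by blast
      let ?P = "insert (A \<union> B) (P - {A, B})"
      have "card ?P \<le> Suc (card (P - {A, B}))"
        by (rule card_insert_le_m1) (use less.prems in auto)
      also have "card (P - {A, B}) = card P - 2"
        using AB less.prems by (subst card_Diff_subset) auto
      finally have "card ?P \<le> Suc (card P - 2)" .
      moreover have "card P \<ge> 2"
        using card_mono[of P "{A, B}"] AB less.prems by simp
      ultimately have cP: "Suc (card ?P) \<le> card P"
        by linarith
      \<comment> \<open>Merging costs at most \<open>2 * (2 ^ t - 1) + 2 = 2 ^ Suc t\<close> arcs,
        which is what the density bound gives up when the family loses a member.\<close>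
      have "2 ^ Suc t * Suc (card ?P) \<le> 2 ^ Suc t * card P"
        using cP by (intro mult_left_mono) auto
      also note less.prems(5)
      also note card_arcs_contract[OF sym less.prems(1) less.prems(3) AB]
      finally have "2 ^ Suc t * card ?P \<le> card (arcs ?l ?P)"
        using few by simp
      moreover have "disjoint ?P"
      proof -
        have "disjoint (P - {A, B})"
          using less.prems(3) by (rule pairwise_subset) auto
        moreover have "(A \<union> B) \<inter> C = {}" if "C \<in> P - {A, B}" for C
          using disjointD[OF less.prems(3), of A C] disjointD[OF less.prems(3), of B C] that AB(1,2)
          by auto
        ultimately show ?thesis
          by (simp only: pairwise_insert disjnt_def) (metis Int_commute)
      qed
      moreover have "conn C" if "C \<in> ?P" for C
        using that less.prems(4) conn_Un[OF less.prems(4)[OF AB(1)] less.prems(4)[OF AB(2)] AB(4)]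
        by blast
      ultimately obtain Q where Q: "finite Q" "card Q = Suc (Suc t)" "disjoint Q" "\<forall>A\<in>Q. conn A"
        "\<forall>A\<in>Q. \<forall>B\<in>Q. A \<noteq> B \<longrightarrow> ?l A B" "\<forall>A\<in>Q. \<exists>S\<subseteq>?P. S \<noteq> {} \<and> A = \<Union>S"
        using less.hyps[of ?P] less.prems(1) cP
        by (metis (no_types, lifting) Suc_le_eq finite_Diff finite_insert insert_not_empty)
      \<comment> \<open>A merged set in the union is replaced by its two parts, which belong to
        \<open>P\<close>.\<close>
      have "\<exists>S\<subseteq>P. S \<noteq> {} \<and> C = \<Union>S" if "C \<in> Q" for C
      proof -
        obtain S where S: "S \<subseteq> ?P" "S \<noteq> {}" "C = \<Union>S"
          using bspec[OF Q(6) \<open>C \<in> Q\<close>] by (elim exE conjE) (rule that)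
        show ?thesis
        proof (cases "A \<union> B \<in> S")
          case True
          then have "C = \<Union> (insert A (insert B (S - {A \<union> B})))"
            using S(3) by auto
          moreover have "insert A (insert B (S - {A \<union> B})) \<subseteq> P"
            using S(1) AB by auto
          ultimately show ?thesis
            by (metis insert_not_empty)
        next
          case False
          with S(1) have "S \<subseteq> P"
            by auto
          with S(2,3) show ?thesis
            by metis
        qed
      qed
      then have "\<forall>C\<in>Q. \<exists>S\<subseteq>P. S \<noteq> {} \<and> C = \<Union>S" ..
      with Q(1-5) show ?thesis
        by (intro exI[of _ Q] conjI)
    next
      case False
      let ?N = "{C \<in> P. C \<noteq> A \<and> ?l A C}"
      have fin: "finite ?N"
        using less.prems(1) by simp
      have "2 ^ t * card ?N = (\<Sum>B\<in>?N. 2 ^ t)"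
        by simp
      \<comment> \<open>The common neighbours of \<open>A\<close> and \<open>B\<close> are the
        neighbours of \<open>B\<close> inside \<open>?N\<close>, so every degree in
        \<open>?N\<close> is at least \<open>2 ^ t\<close>.\<close>
      also have "\<dots> \<le> (\<Sum>B\<in>?N. card {C \<in> ?N. C \<noteq> B \<and> ?l B C})"
      proof (rule sum_mono)
        fix B assume B: "B \<in> ?N"
        then have "2 ^ t \<le> card {C \<in> P - {A, B}. ?l A C \<and> ?l B C}"
          using False AB(1) by (auto simp: not_less)
        also have "{C \<in> P - {A, B}. ?l A C \<and> ?l B C} = {C \<in> ?N. C \<noteq> B \<and> ?l B C}"
          by auto
        finally show "2 ^ t \<le> card {C \<in> ?N. C \<noteq> B \<and> ?l B C}" .
      qed
      also have "\<dots> = card (arcs ?l ?N)"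
        by (simp add: card_arcs_eq_sum[OF fin])
      finally have "2 ^ t * card ?N \<le> card (arcs ?l ?N)" .
      moreover have "?N \<noteq> {}"
        using AB by auto
      moreover have "disjoint ?N"
        using less.prems(3) by (auto simp: disjoint_def)
      ultimately obtain Q where Q: "finite Q" "card Q = Suc t" "disjoint Q" "\<forall>A\<in>Q. conn A"
        "\<forall>A\<in>Q. \<forall>B\<in>Q. A \<noteq> B \<longrightarrow> ?l A B" "\<forall>A\<in>Q. \<exists>S\<subseteq>?N. S \<noteq> {} \<and> A = \<Union>S"
        using outer[of ?N] fin less.prems(4)
        by (metis (no_types, lifting) mem_Collect_eq)
      \<comment> \<open>Every member of \<open>Q\<close> is a nonempty union of neighbours of
        \<open>A\<close>. Hence \<open>A\<close> can be added as the missing member of the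
        minor.\<close>
      have lQ: "?l A C" if "C \<in> Q" for C
        using Q(6) that by (fastforce simp: linked_def)
      have dQ: "A \<inter> C = {}" if "C \<in> Q" for C
      proof -
        obtain S where "S \<subseteq> ?N" "C = \<Union>S"
          using bspec[OF Q(6) \<open>C \<in> Q\<close>] by (elim exE conjE) (rule that)
        moreover have "A \<inter> X = {}" if "X \<in> ?N" for X
          using less.prems(3) AB(1) that by (auto simp: disjoint_def)
        ultimately show ?thesis
          by blast
      qed
      have "A \<noteq> {}"
        using AB(4) by (auto simp: linked_def)
      with dQ have "A \<notin> Q"
        by blast
      show ?thesis
      proof (intro exI[of _ "insert A Q"] conjI)
        show "card (insert A Q) = Suc (Suc t)"
          using Q \<open>A \<notin> Q\<close> by simp
        show "disjoint (insert A Q)"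
          using Q(3) dQ by (auto simp: disjoint_def)
        show "\<forall>C\<in>insert A Q. conn C"
          using Q(4) AB(1) less.prems(4) by auto
        show "\<forall>C\<in>insert A Q. \<forall>D\<in>insert A Q. C \<noteq> D \<longrightarrow> ?l C D"
          using Q(5) lQ syml by (metis insertE)
        show "\<forall>C\<in>insert A Q. \<exists>S\<subseteq>P. S \<noteq> {} \<and> C = \<Union>S"
        proof
          fix C assume "C \<in> insert A Q"
          then show "\<exists>S\<subseteq>P. S \<noteq> {} \<and> C = \<Union>S"
          proof
            assume "C = A"
            with AB(1) show ?thesis
              by (intro exI[of _ "{A}"]) auto
          next
            assume CQ: "C \<in> Q"
            obtain S where "S \<subseteq> ?N" "S \<noteq> {}" "C = \<Union>S"
              using bspec[OF Q(6) CQ] by (elim exE conjE) (rule that)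
            moreover from this have "S \<subseteq> P"
              by auto
            ultimately show ?thesis
              by metis
          qed
        qed
      qed (use Q in auto)
    qed
  qed
qed

text \<open>Greedy choice: the average degree is below \<open>d\<close>, so some vertex has fewer
  than \<open>d\<close> neighbours. It is selected and deleted with its neighbours, at most
  \<open>d\<close> vertices in all; sparsity passes to the rest.\<close>

lemma large_independent_set:
  assumes sym: "symp E" and fin: "finite V"
    and sparse: "\<And>W. W \<subseteq> V \<Longrightarrow> W \<noteq> {} \<Longrightarrow> card (arcs E W) < d * card W"
  shows "\<exists>I\<subseteq>V. card V \<le> d * card I \<and> (\<forall>x\<in>I. \<forall>y\<in>I. x \<noteq> y \<longrightarrow> \<not> E x y)"
  using fin sparse
proof (induction "card V" arbitrary: V rule: less_induct)
  case less
  show ?case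
  proof (cases "V = {}")
    case False
    let ?N = "\<lambda>x. {y \<in> V. y \<noteq> x \<and> E x y}"
    have "\<exists>x\<in>V. card (?N x) < d"
    proof (rule ccontr)
      assume "\<not> ?thesis"
      then have "(\<Sum>x\<in>V. d) \<le> (\<Sum>x\<in>V. card (?N x))"
        by (intro sum_mono) auto
      also have "\<dots> = card (arcs E V)"
        using less.prems by (simp add: card_arcs_eq_sum)
      finally show False
        using less.prems(2)[OF subset_refl False] by (simp add: mult.commute)
    qed
    then obtain x where x: "x \<in> V" "card (?N x) < d"
      by blast
    let ?V = "V - insert x (?N x)"
    have fN: "finite (?N x)"
      using less.prems by simp
    have "card ?V < card V"
      using x less.prems by (intro psubset_card_mono) auto
    then obtain I where I: "I \<subseteq> ?V" "card ?V \<le> d * card I" "\<forall>x\<in>I. \<forall>y\<in>I. x \<noteq> y \<longrightarrow> \<not> E x y"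
      using less.hyps[of ?V] less.prems Diff_subset[of V "insert x (?N x)"] by (meson finite_Diff order_trans)
    have "card V \<le> card ?V + card (insert x (?N x))"
      by (rule order_trans[OF card_mono card_Un_le]) (use less.prems(1) fN in auto)
    also have "card (insert x (?N x)) \<le> d"
      using x(2) card_insert_le_m1[of d "?N x" x] by simp
    also have "card ?V + d \<le> d * Suc (card I)"
      using I(2) by simp
    also have "Suc (card I) = card (insert x I)"
      using I(1) finite_subset[OF I(1)] less.prems(1)
      by (metis (no_types, lifting) Diff_iff card_insert_disjoint finite_Diff insertI1 subset_iff)
    finally have "card V \<le> d * card (insert x I)"
      by simp
    moreover have "\<forall>a\<in>insert x I. \<forall>b\<in>insert x I. a \<noteq> b \<longrightarrow> \<not> E a b"
      using I(1,3) sym unfolding symp_def by blast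
    ultimately show ?thesis
      using I(1) x(1) by (intro exI[of _ "insert x I"]) auto
  qed simp
qed

section \<open>Additively weighted Voronoi regions and their Delaunay graph\<close>

locale weighted_sites =
  fixes F :: "'a set" and c :: "'a \<Rightarrow> complex" and r :: "'a \<Rightarrow> real" and h :: "'a \<Rightarrow> nat"
  assumes finite_sites: "finite F" and inj_index: "inj_on h F"
begin

text \<open>The additively weighted distance. For nonnegative radii, \<open>cball x s\<close> meets
  the disc of \<open>i\<close> exactly if \<open>gap x i \<le> s\<close>.\<close>

definition gap :: "complex \<Rightarrow> 'a \<Rightarrow> real" where
  "gap x i = dist x (c i) - r i"

definition before :: "complex \<Rightarrow> 'a \<Rightarrow> 'a \<Rightarrow> bool" where
  "before x i k \<longleftrightarrow> gap x i < gap x k \<or> gap x i = gap x k \<and> h i < h k"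

text \<open>The order between \<open>i\<close> and \<open>j\<close> is left open, so every point
  \<open>x\<close> yields an edge once \<open>F\<close> has two members.\<close>

definition delaunay :: "'a \<Rightarrow> 'a \<Rightarrow> bool" where
  "delaunay i j \<longleftrightarrow> i \<in> F \<and> j \<in> F \<and> i \<noteq> j \<and> (\<exists>x. \<forall>k\<in>F - {i, j}. before x i k \<and> before x j k)"

text \<open>For \<open>W \<subseteq> F\<close> this is the union of the weighted Voronoi cells of
  the members of \<open>W\<close>, with ties decided by \<open>h\<close>.\<close>

definition region :: "'a set \<Rightarrow> complex set" where
  "region W = {x. \<exists>i\<in>W. \<forall>k\<in>F - W. before x i k}"

text \<open>The case \<open>i = j\<close> is separate because the centre of a disc that is hidden by the
  others does not lie in the region of that disc.\<close>

definition linked_in_region :: "'a set \<Rightarrow> bool" where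
  "linked_in_region W \<longleftrightarrow>
    W \<subseteq> F \<and> (\<forall>i\<in>W. \<forall>j\<in>W. i = j \<or> path_component (region W) (c i) (c j))"

lemma symp_delaunay: "symp delaunay"
  unfolding symp_def delaunay_def by (metis insert_commute)

lemma before_antisym: "before x i k \<Longrightarrow> \<not> before x k i"
  by (auto simp: before_def)

lemma before_gap: "before x i k \<Longrightarrow> gap x i \<le> gap x k"
  by (auto simp: before_def)

text \<open>Moving from \<open>x\<close> to \<open>y\<close> lowers the gap of \<open>i\<close> by
  exactly \<open>dist x y\<close>, and that of \<open>k\<close> by at most this amount.\<close>

lemma before_towards_centre:
  assumes "before x i k" "y \<in> closed_segment x (c i)"
  shows "before y i k"
proof -
  have "dist x (c i) = dist x y + dist y (c i)"
    using assms(2) between between_mem_segment by metis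
  moreover have "dist x (c k) \<le> dist x y + dist y (c k)"
    by (rule dist_triangle)
  ultimately show ?thesis
    using assms(1) by (auto simp: before_def gap_def)
qed

lemma region_mono: "W \<subseteq> W' \<Longrightarrow> region W \<subseteq> region W'"
  by (auto simp: region_def)

lemma region_disjoint:
  assumes "W \<subseteq> F" "W' \<subseteq> F" "W \<inter> W' = {}"
  shows "region W \<inter> region W' = {}"
proof (rule ccontr)
  assume "region W \<inter> region W' \<noteq> {}"
  then obtain x i j where "i \<in> W" "j \<in> W'" "\<forall>k\<in>F - W. before x i k" "\<forall>k\<in>F - W'. before x j k"
    by (auto simp: region_def)
  with assms have "before x i j" "before x j i"
    by blast+
  then show False
    using before_antisym by blast
qed

lemma delaunay_path_component:
  assumes "delaunay i j"
  shows "path_component (region {i, j}) (c i) (c j)"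
proof -
  obtain x where x: "\<And>k. k \<in> F - {i, j} \<Longrightarrow> before x i k \<and> before x j k"
    using assms by (auto simp: delaunay_def)
  have *: "path_component (region {i, j}) x (c l)" if "l = i \<or> l = j" for l
    unfolding path_component_def
  proof (intro exI[of _ "linepath x (c l)"] conjI)
    show "path_image (linepath x (c l)) \<subseteq> region {i, j}"
      unfolding path_image_linepath region_def
      using that x by (blast intro: before_towards_centre)
  qed auto
  show ?thesis
    by (rule path_component_trans[OF path_component_sym[OF *] *]) auto
qed

text \<open>Paths inside the regions of \<open>A\<close> and \<open>B\<close> stay in the larger
  region by monotonicity, and the edge \<open>a b\<close> supplies a bridge inside the region of
  \<open>{a, b}\<close>.\<close>

lemma linked_in_region_Un:
  assumes A: "linked_in_region A" and B: "linked_in_region B" and l: "linked delaunay A B"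
  shows "linked_in_region (A \<union> B)"
proof -
  obtain a b where ab: "a \<in> A" "b \<in> B" "delaunay a b"
    using l by (auto simp: linked_def)
  let ?R = "region (A \<union> B)"
  have ab': "path_component ?R (c a) (c b)"
    using delaunay_path_component[OF ab(3)] ab(1,2)
    by (elim path_component_of_subset[OF region_mono, rotated]) auto
  have incl: "path_component ?R (c i) (c j)"
    if "linked_in_region W" "W \<subseteq> A \<union> B" "i \<in> W" "j \<in> W" "i \<noteq> j" for W i j
    using that path_component_of_subset[OF region_mono[OF that(2)]]
    unfolding linked_in_region_def by blast
  \<comment> \<open>All centres are connected to \<open>c a\<close>. The cases \<open>i = a\<close>
    and \<open>i = b\<close> rest on the bridge, since \<open>linked_in_region\<close> says nothing
    about equal indices.\<close>
  have toa: "path_component ?R (c i) (c a)" if "i \<in> A \<union> B" for i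
  proof (cases "i = a")
    case True
    then show ?thesis
      using ab' by (metis path_component_mem(1) path_component_refl)
  next
    case False
    show ?thesis
    proof (cases "i \<in> A")
      case True
      then show ?thesis
        using incl[OF A _ _ ab(1)] False by blast
    next
      case nA: False
      show ?thesis
      proof (cases "i = b")
        case True
        then show ?thesis
          using ab' path_component_sym by metis
      next
        case False
        then have "path_component ?R (c i) (c b)"
          using incl[OF B _ _ ab(2)] nA that by blast
        then show ?thesis
          using ab' path_component_sym path_component_trans by metis
      qed
    qed
  qed
  have "path_component ?R (c i) (c j)" if "i \<in> A \<union> B" "j \<in> A \<union> B" for i j
    using toa[OF that(1)] toa[OF that(2)] path_component_sym path_component_trans by metis
  then show ?thesis
    using A B unfolding linked_in_region_def by simp
qed

text \<open>Arbitrary members \<open>v i\<close> of the five sets give the vertices. The union of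
  two of the sets is again linked in its region, which supplies the arc; edges without common
  endpoint have disjoint unions and hence disjoint regions.\<close>

lemma delaunay_no_K5:
  assumes Q: "finite Q" "card Q = 5" "disjoint Q" "{} \<notin> Q"
    and conn: "\<And>A. A \<in> Q \<Longrightarrow> linked_in_region A"
    and adj: "\<And>A B. A \<in> Q \<Longrightarrow> B \<in> Q \<Longrightarrow> A \<noteq> B \<Longrightarrow> linked delaunay A B"
  shows False
proof -
  obtain f where f: "bij_betw f {..<5::nat} Q"
    using ex_bij_betw_nat_finite[OF Q(1)] Q(2) by (auto simp: atLeast0LessThan)
  have fQ: "f i \<in> Q" if "i < 5" for i
    using f that by (auto simp: bij_betw_def)
  have dis: "f i \<inter> f j = {}" if "i < 5" "j < 5" "i \<noteq> j" for i j
    using disjointD[OF Q(3) fQ[OF that(1)] fQ[OF that(2)]] f that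
    by (auto simp: bij_betw_def dest: inj_onD)
  have "\<exists>x. x \<in> f i" if "i < 5" for i
    using fQ[OF that] Q(4) by (metis equals0I)
  then obtain v where v: "\<And>i. i < 5 \<Longrightarrow> v i \<in> f i"
    by metis
  have "\<exists>p. path p \<and> path_image p \<subseteq> region (f i \<union> f j) \<and> pathstart p = c (v i) \<and> pathfinish p = c (v j)"
    if "i < j" "j < 5" for i j
  proof -
    have i: "i < 5"
      using that by simp
    have "linked_in_region (f i \<union> f j)"
    proof (rule linked_in_region_Un)
      have "f i \<noteq> f j"
        using dis[of i j] v[OF i] i that by auto
      then show "linked delaunay (f i) (f j)"
        using adj fQ i that by blast
    qed (use conn fQ i that in auto)
    moreover have "v i \<noteq> v j"
      using dis[of i j] v[of i] v[of j] i that by auto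
    ultimately show ?thesis
      using v[of i] v[of j] i that unfolding linked_in_region_def path_component_def by blast
  qed
  then obtain g where g: "\<And>i j. i < j \<Longrightarrow> j < 5 \<Longrightarrow> path (g i j) \<and> path_image (g i j) \<subseteq> region (f i \<union> f j) \<and>
      pathstart (g i j) = c (v i) \<and> pathfinish (g i j) = c (v j)"
    by metis
  have sub: "f i \<union> f j \<subseteq> F" if "i < 5" "j < 5" for i j
    using conn fQ that unfolding linked_in_region_def by auto
  show False
  proof (rule no_planar_complete_graph_5[of g "\<lambda>i. c (v i)"])
    show "path_image (g i j) \<inter> path_image (g k l) = {}"
      if "i < j" "j < 5" "k < l" "l < 5" "{i, j} \<inter> {k, l} = {}" for i j k l
    proof -
      have "region (f i \<union> f j) \<inter> region (f k \<union> f l) = {}"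
        using that by (intro region_disjoint sub) (auto simp: Int_Un_distrib Int_Un_distrib2 dis)
      then show ?thesis
        using g[OF that(1,2)] g[OF that(3,4)] by blast
    qed
  qed (use g in blast)
qed

text \<open>The constant is \<open>2 ^ 4\<close>: starting from singletons, this density would
  produce \<open>Suc 4\<close> pairwise linked sets.\<close>

lemma delaunay_sparse:
  assumes W: "W \<subseteq> F" "W \<noteq> {}"
  shows "card (arcs delaunay W) < 16 * card W"
proof (rule ccontr)
  assume dense: "\<not> ?thesis"
  let ?s = "\<lambda>i::'a. {i}"
  have fin: "finite W"
    using W finite_sites finite_subset by blast
  have "arcs (linked delaunay) (?s ` W) = map_prod ?s ?s ` arcs delaunay W"
    by (auto simp: arcs_def linked_def)
  moreover have "card (map_prod ?s ?s ` arcs delaunay W) = card (arcs delaunay W)"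
    by (rule card_image) (auto simp: inj_on_def)
  moreover have "card (?s ` W) = card W"
    by (rule card_image) simp
  ultimately have dens: "2 ^ 4 * card (?s ` W) \<le> card (arcs (linked delaunay) (?s ` W))"
    using dense by simp
  have "\<exists>Q. finite Q \<and> card Q = Suc 4 \<and> disjoint Q \<and> (\<forall>A\<in>Q. linked_in_region A) \<and>
    (\<forall>A\<in>Q. \<forall>B\<in>Q. A \<noteq> B \<longrightarrow> linked delaunay A B) \<and> (\<forall>A\<in>Q. \<exists>S\<subseteq>?s ` W. S \<noteq> {} \<and> A = \<Union>S)"
  proof (rule dense_family_has_complete_minor[OF symp_delaunay _ _ _ _ _ dens])
    show "linked_in_region (A \<union> B)"
      if "linked_in_region A" "linked_in_region B" "linked delaunay A B" for A B
      using that by (rule linked_in_region_Un)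
    show "disjoint (?s ` W)"
      by (auto simp: disjoint_def)
    show "linked_in_region A" if "A \<in> ?s ` W" for A
      using that W(1) by (auto simp: linked_in_region_def)
  qed (use fin W in auto)
  then obtain Q where Q: "finite Q" "card Q = Suc 4" "disjoint Q" "\<forall>A\<in>Q. linked_in_region A"
    "\<forall>A\<in>Q. \<forall>B\<in>Q. A \<noteq> B \<longrightarrow> linked delaunay A B" "\<forall>A\<in>Q. \<exists>S\<subseteq>?s ` W. S \<noteq> {} \<and> A = \<Union>S"
    by (elim exE conjE) (rule that)
  have "{} \<notin> Q"
  proof
    assume "{} \<in> Q"
    then obtain S where "S \<subseteq> ?s ` W" "S \<noteq> {}" "{} = \<Union>S"
      using bspec[OF Q(6)] by metis
    then show False
      by blast
  qed
  then show False
    using delaunay_no_K5[of Q] Q(1-5) by simp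
qed

lemma exists_first:
  assumes "A \<subseteq> F" "A \<noteq> {}"
  shows "\<exists>i\<in>A. \<forall>k\<in>A - {i}. before x i k"
proof -
  have fin: "finite A"
    using assms finite_sites finite_subset by blast
  let ?m = "Min (gap x ` A)"
  let ?A = "{i \<in> A. gap x i = ?m}"
  have "?m \<in> gap x ` A"
    using fin assms by (intro Min_in) auto
  then have "?A \<noteq> {}"
    by auto
  then obtain i where i: "i \<in> ?A" "\<And>k. k \<in> ?A \<Longrightarrow> h i \<le> h k"
    using ex_min_if_finite[of "h ` ?A"] fin by (auto simp: not_less)
  have "before x i k" if "k \<in> A - {i}" for k
  proof (cases "gap x k = ?m")
    case True
    then have "h i \<le> h k"
      using i(2) that by simp
    moreover have "h i \<noteq> h k"
      using inj_index i(1) that assms(1) by (auto dest: inj_onD)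
    ultimately show ?thesis
      using i(1) True by (simp add: before_def)
  next
    case False
    moreover have "?m \<le> gap x k"
      using fin that by simp
    ultimately show ?thesis
      using i(1) by (simp add: before_def)
  qed
  with i(1) show ?thesis
    by blast
qed

text \<open>The first two sites at \<open>x\<close> are joined, and if two sites have gap at most
  \<open>s\<close>, then so do the first two.\<close>

lemma delaunay_pair_in_ball:
  assumes A: "A = {k \<in> F. gap x k \<le> s}" and ne: "a \<in> A" "b \<in> A" "a \<noteq> b"
  shows "\<exists>i\<in>A. \<exists>j\<in>A. delaunay i j"
proof -
  obtain i where i: "i \<in> F" "\<And>k. k \<in> F - {i} \<Longrightarrow> before x i k"
    using exists_first[of F x] ne A by auto
  have "F - {i} \<noteq> {}"
    using ne A by auto
  then obtain j where j: "j \<in> F - {i}" "\<And>k. k \<in> F - {i} - {j} \<Longrightarrow> before x j k"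
    using exists_first[of "F - {i}" x] by blast
  have "delaunay i j"
    unfolding delaunay_def using i j by blast
  have first: "gap x i \<le> gap x k" if "k \<in> F" for k
    using i(2)[of k] that before_gap by fastforce
  have second: "gap x j \<le> gap x k" if "k \<in> F - {i}" for k
    using j(2)[of k] that before_gap by fastforce
  \<comment> \<open>At least one of \<open>a\<close> and \<open>b\<close> differs from
    \<open>i\<close>, and \<open>j\<close> comes no later than that one.\<close>
  have "gap x j \<le> s"
    using second[of a] second[of b] ne A by fastforce
  moreover have "gap x i \<le> s"
    using first[of a] ne A by fastforce
  ultimately show ?thesis
    using \<open>delaunay i j\<close> i(1) j(1) A by blast
qed

end

section \<open>Conflict-free colouring of discs with logarithmically many colours\<close>

lemma cball_Int_cball_nonempty_iff:
  fixes a b :: "'a::real_normed_vector"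
  assumes "0 \<le> r" "0 \<le> s"
  shows "cball a r \<inter> cball b s \<noteq> {} \<longleftrightarrow> dist a b \<le> r + s"
proof
  assume "cball a r \<inter> cball b s \<noteq> {}"
  then obtain y where "dist a y \<le> r" "dist b y \<le> s"
    by auto
  then show "dist a b \<le> r + s"
    using dist_triangle2[of a b y] by linarith
next
  assume le: "dist a b \<le> r + s"
  show "cball a r \<inter> cball b s \<noteq> {}"
  proof (cases "dist a b \<le> s")
    case True
    then have "a \<in> cball a r \<inter> cball b s"
      using assms by (simp add: dist_commute)
    then show ?thesis
      by blast
  next
    case False
    \<comment> \<open>This places \<open>y\<close> on the segment from \<open>b\<close> to
      \<open>a\<close>, at distance exactly \<open>s\<close> from \<open>b\<close>.\<close>
    define t where "t = s / dist a b"
    have t: "0 \<le> t" "t \<le> 1" "t * dist a b = s"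
      using False assms by (auto simp: t_def divide_simps)
    define y where "y = b + t *\<^sub>R (a - b)"
    have "b - y = t *\<^sub>R (b - a)" "a - y = (1 - t) *\<^sub>R (a - b)"
      by (simp_all add: y_def algebra_simps)
    then have "dist b y = t * dist a b" "dist a y = (1 - t) * dist a b"
      using t by (simp_all add: dist_norm norm_minus_commute)
    then have "y \<in> cball a r \<inter> cball b s"
      using t le by (simp add: left_diff_distrib)
    then show ?thesis
      by blast
  qed
qed

text \<open>The hit set of \<open>cball x s\<close> consists of the discs with gap at most
  \<open>s\<close> at \<open>x\<close>. Two different members would force a Delaunay edge inside
  \<open>I\<close>.\<close>

lemma discs_large_independent_set:
  assumes fin: "finite F" and discs: "\<forall>D\<in>F. is_disc D"
  shows "\<exists>I\<subseteq>F. card F \<le> 16 * card I \<and>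
    (\<forall>B. is_disc B \<longrightarrow> hit_set F B \<subseteq> I \<longrightarrow> (\<forall>D\<in>hit_set F B. \<forall>D'\<in>hit_set F B. D = D'))"
proof -
  obtain c r where cr: "\<And>D. D \<in> F \<Longrightarrow> r D \<ge> 0 \<and> D = cball (c D) (r D)"
    using discs unfolding is_disc_def by metis
  obtain h :: "complex set \<Rightarrow> nat" where h: "inj_on h F"
    using finite_imp_inj_to_nat_seg[OF fin] by blast
  interpret weighted_sites F c r h
    using fin h by unfold_locales
  obtain I where I: "I \<subseteq> F" "card F \<le> 16 * card I" "\<forall>x\<in>I. \<forall>y\<in>I. x \<noteq> y \<longrightarrow> \<not> delaunay x y"
    using large_independent_set[OF symp_delaunay fin delaunay_sparse] by auto
  have "D = D'" if B: "is_disc B" "hit_set F B \<subseteq> I" and D: "D \<in> hit_set F B" "D' \<in> hit_set F B" for B D D'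
  proof (rule ccontr)
    assume "D \<noteq> D'"
    obtain x s where xs: "s \<ge> 0" "B = cball x s"
      using B(1) by (auto simp: is_disc_def)
    have "D \<inter> B \<noteq> {} \<longleftrightarrow> gap x D \<le> s" if "D \<in> F" for D
      using cball_Int_cball_nonempty_iff[of "r D" s "c D" x] cr[OF that] xs
      by (auto simp: gap_def dist_commute)
    then have "hit_set F B = {D \<in> F. gap x D \<le> s}"
      by (auto simp: hit_set_def)
    from delaunay_pair_in_ball[OF this D \<open>D \<noteq> D'\<close>]
    obtain i j where ij: "i \<in> hit_set F B" "j \<in> hit_set F B" "delaunay i j"
      by blast
    then have "i \<noteq> j"
      by (simp add: delaunay_def)
    then show False
      using ij B(2) I(3) by blast
  qed
  with I(1,2) show ?thesis
    by (intro exI[of _ I]) blast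
qed

text \<open>Each colour removes at least a sixteenth of the discs, so at most \<open>15 / 16\<close>
  of them remain. The factor \<open>16 / 15\<close> on the right pays for the last colour, when
  \<open>k = 1\<close> and \<open>card F\<close> may be 1.\<close>

lemma discs_cf_coloring:
  assumes "finite F" "F \<noteq> {}" "\<forall>D\<in>F. is_disc D"
  shows "\<exists>col k. cf_coloring F col \<and> col ` F \<subseteq> {..<k} \<and> (16 / 15) ^ k \<le> 16 / 15 * real (card F)"
  using assms
proof (induction "card F" arbitrary: F rule: less_induct)
  case less
  obtain I where I: "I \<subseteq> F" "card F \<le> 16 * card I"
    and single: "\<And>B D D'. is_disc B \<Longrightarrow> hit_set F B \<subseteq> I \<Longrightarrow> D \<in> hit_set F B \<Longrightarrow> D' \<in> hit_set F B \<Longrightarrow> D = D'"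
    using discs_large_independent_set[OF less.prems(1,3)] by metis
  have cF: "card F > 0"
    using less.prems by (simp add: card_gt_0_iff)
  show ?case
  proof (cases "F - I = {}")
    case True
    have "cf_coloring F (\<lambda>_. 0)"
      unfolding cf_coloring_def
    proof (intro allI impI)
      fix B assume B: "is_disc B" "hit_set F B \<noteq> {}"
      then obtain D where D: "D \<in> hit_set F B"
        by blast
      have "hit_set F B \<subseteq> I"
        using True by (auto simp: hit_set_def)
      then show "\<exists>D\<in>hit_set F B. \<forall>D'\<in>hit_set F B. D' \<noteq> D \<longrightarrow> (0::nat) \<noteq> 0"
        using single[OF B(1)] D by blast
    qed
    then show ?thesis
      using cF by (intro exI[of _ "\<lambda>_. 0"] exI[of _ 1]) auto
  next
    case False
    have cI: "card (F - I) = card F - card I" "card I \<le> card F"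
      using I(1) less.prems(1) finite_subset by (auto intro: card_Diff_subset card_mono)
    moreover have "card I > 0"
      using I(2) cF by linarith
    ultimately have "card (F - I) < card F"
      using cF by linarith
    then obtain col k where col: "cf_coloring (F - I) col" "col ` (F - I) \<subseteq> {..<k}"
      and k: "(16 / 15) ^ k \<le> 16 / 15 * real (card (F - I))"
      using less.hyps[of "F - I"] less.prems False by auto
    \<comment> \<open>Colour 0 is reserved for \<open>I\<close>, so a disc with unique colour among
      the hit discs outside \<open>I\<close> keeps a unique colour in the whole hit set.\<close>
    define col' where "col' D = (if D \<in> I then 0 else Suc (col D))" for D
    have "cf_coloring F col'"
      unfolding cf_coloring_def
    proof (intro allI impI)
      fix B assume B: "is_disc B" "hit_set F B \<noteq> {}"
      show "\<exists>D\<in>hit_set F B. \<forall>D'\<in>hit_set F B. D' \<noteq> D \<longrightarrow> col' D' \<noteq> col' D"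
      proof (cases "hit_set (F - I) B = {}")
        case True
        then have "hit_set F B \<subseteq> I"
          by (auto simp: hit_set_def)
        then show ?thesis
          using single[OF B(1)] B(2) by blast
      next
        case False
        then obtain D where "D \<in> hit_set (F - I) B"
            "\<forall>D'\<in>hit_set (F - I) B. D' \<noteq> D \<longrightarrow> col D' \<noteq> col D"
          using col(1) B(1) unfolding cf_coloring_def by blast
        then show ?thesis
          by (intro bexI[of _ D]) (auto simp: hit_set_def col'_def)
      qed
    qed
    moreover have "col' ` F \<subseteq> {..<Suc k}"
      using col(2) by (auto simp: col'_def)
    moreover have "(16 / 15) ^ Suc k \<le> 16 / 15 * real (card F)"
    proof -
      have "real (card (F - I)) = real (card F) - real (card I)"
        using cI by simp
      moreover have "real (card F) \<le> 16 * real (card I)"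
        using I(2) by linarith
      ultimately have "16 * real (card (F - I)) \<le> 15 * real (card F)"
        by linarith
      then show ?thesis
        using k by simp
    qed
    ultimately show ?thesis
      by blast
  qed
qed

lemma discs_cf_coloring_log:
  assumes "finite F" "card F \<ge> 2" "\<forall>D\<in>F. is_disc D"
  shows "\<exists>col. cf_coloring F col \<and> real (card (col ` F)) \<le> (1 / ln 2 + 1 / ln (16 / 15)) * ln (real (card F))"
proof -
  have "F \<noteq> {}"
    using assms(2) by auto
  then obtain col k where col: "cf_coloring F col" "col ` F \<subseteq> {..<k}"
    and k: "(16 / 15) ^ k \<le> 16 / 15 * real (card F)"
    using discs_cf_coloring[OF assms(1) _ assms(3)] by blast
  let ?n = "real (card F)" and ?q = "16 / 15 :: real"
  have "real (card (col ` F)) \<le> real k"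
    using card_mono[OF _ col(2)] by simp
  also have "real k \<le> 1 + ln ?n / ln ?q"
  proof -
    have "real k * ln ?q = ln (?q ^ k)"
      by (simp add: ln_realpow)
    also have "\<dots> \<le> ln (?q * ?n)"
      using k assms(2) by (subst ln_le_cancel_iff) auto
    also have "\<dots> = ln ?q + ln ?n"
      using assms(2) by (subst ln_mult) auto
    finally show ?thesis
      by (simp add: field_simps)
  qed
  \<comment> \<open>With at least two discs the additive 1 is absorbed into the logarithm; this is
    the summand \<open>1 / ln 2\<close> of the constant.\<close>
  also have "1 \<le> ln ?n / ln 2"
    using assms(2) by simp
  finally show ?thesis
    using col(1) by (intro exI[of _ col]) (simp add: distrib_right)
qed

section \<open>The lower bound for collinear points\<close>

text \<open>Both sides of a uniquely coloured \<open>m\<close> avoid its colour, so the induction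
  applies to each with \<open>K - {col m}\<close>. The count is
  \<open>2 * (2 ^ k - 1) + 1 < 2 ^ Suc k\<close>. As \<open>K\<close> is a superset of the colours
  used, the same smaller set serves both sides.\<close>

lemma interval_unique_color_bound:
  fixes col :: "nat \<Rightarrow> nat"
  assumes "finite K" "col ` {a..<b} \<subseteq> K"
    and "\<And>i j. a \<le> i \<Longrightarrow> i < j \<Longrightarrow> j \<le> b \<Longrightarrow>
      \<exists>m\<in>{i..<j}. \<forall>m'\<in>{i..<j}. m' \<noteq> m \<longrightarrow> col m' \<noteq> col m"
  shows "b - a < 2 ^ card K"
  using assms
proof (induction "card K" arbitrary: K a b)
  case 0
  then show ?case
    by simp
next
  case (Suc k)
  show ?case
  proof (cases "a < b")
    case True
    then obtain m where m: "m \<in> {a..<b}" "\<And>m'. m' \<in> {a..<b} \<Longrightarrow> m' \<noteq> m \<Longrightarrow> col m' \<noteq> col m"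
      using Suc.prems(3)[of a b] by auto
    have mK: "col m \<in> K"
      using Suc.prems(2) m(1) by blast
    let ?K = "K - {col m}"
    have K: "k = card ?K" "finite ?K"
      using Suc.hyps(2) Suc.prems(1) mK by auto
    have "m - a < 2 ^ card ?K"
    proof (rule Suc.hyps(1)[OF K])
      show "col ` {a..<m} \<subseteq> ?K"
        using Suc.prems(2) m by fastforce
    qed (use Suc.prems(3) m(1) in auto)
    moreover have "b - Suc m < 2 ^ card ?K"
    proof (rule Suc.hyps(1)[OF K])
      show "col ` {Suc m..<b} \<subseteq> ?K"
        using Suc.prems(2) m by fastforce
    qed (use Suc.prems(3) m(1) in auto)
    moreover have "card K = Suc (card ?K)"
      using Suc.hyps(2) K by simp
    ultimately show ?thesis
      using m(1) by simp
  qed simp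
qed

lemma collinear_points_lower_bound:
  fixes n :: nat
  assumes n: "n \<ge> 1" and F: "F = (\<lambda>k. {complex_of_nat k}) ` {..<n}" and cf: "cf_coloring F col"
  shows "ln (real n) \<le> real (card (col ` F))"
proof -
  let ?p = "\<lambda>k. {complex_of_nat k}"
  have "n - 0 < 2 ^ card (col ` F)"
  proof (rule interval_unique_color_bound[where col = "\<lambda>k. col (?p k)"])
    fix i j :: nat assume ij: "0 \<le> i" "i < j" "j \<le> n"
    \<comment> \<open>The disc whose diameter runs from \<open>i\<close> to \<open>j - 1\<close>;
      for a single point its radius is 0.\<close>
    let ?B = "cball (complex_of_real ((real i + real j - 1) / 2)) ((real j - 1 - real i) / 2)"
    have mem: "complex_of_nat k \<in> ?B \<longleftrightarrow> k \<in> {i..<j}" for k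
    proof -
      have "dist (complex_of_real ((real i + real j - 1) / 2)) (complex_of_nat k) =
          \<bar>(real i + real j - 1) / 2 - real k\<bar>"
        by (metis dist_of_real dist_real_def of_real_of_nat_eq)
      then show ?thesis
        using ij by (auto simp: abs_le_iff field_simps)
    qed
    have hit: "hit_set F ?B = ?p ` {i..<j}"
      unfolding hit_set_def F using mem ij by auto
    have "is_disc ?B"
      unfolding is_disc_def using ij
      by (intro exI[of _ "complex_of_real ((real i + real j - 1) / 2)"] exI[of _ "(real j - 1 - real i) / 2"]) auto
    moreover have "hit_set F ?B \<noteq> {}"
      unfolding hit using ij by auto
    ultimately have "\<exists>D\<in>?p ` {i..<j}. \<forall>D'\<in>?p ` {i..<j}. D' \<noteq> D \<longrightarrow> col D' \<noteq> col D"
      using cf unfolding cf_coloring_def hit[symmetric] by blast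
    then show "\<exists>m\<in>{i..<j}. \<forall>m'\<in>{i..<j}. m' \<noteq> m \<longrightarrow> col (?p m') \<noteq> col (?p m)"
      by auto
  qed (auto simp: F)
  then have "real n \<le> real (2 ^ card (col ` F))"
    by linarith
  then have "ln (real n) \<le> ln (2 ^ card (col ` F))"
    using n by (subst ln_le_cancel_iff) auto
  also have "\<dots> = real (card (col ` F)) * ln 2"
    by (simp add: ln_realpow)
  \<comment> \<open>The estimate \<open>ln 2 \<le> 1\<close> allows the constant 1 in the lower
    bound.\<close>
  also have "\<dots> \<le> real (card (col ` F)) * 1"
    using ln_le_minus_one[of "2::real"] by (intro mult_left_mono) auto
  finally show ?thesis
    by simp
qed

theorem theorem1p4:
  shows "(\<exists>C::real. \<forall>n::nat. n \<ge> 2 \<longrightarrow>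
            (\<forall>F. finite F \<and> card F = n \<and> (\<forall>D\<in>F. is_disc D) \<longrightarrow>
               (\<exists>col. cf_coloring F col \<and> real (card (col ` F)) \<le> C * ln (real n))))
       \<and> (\<exists>c::real. c > 0 \<and> (\<forall>n::nat. n \<ge> 2 \<longrightarrow>
            (\<exists>F. finite F \<and> card F = n \<and> (\<forall>D\<in>F. is_disc D) \<and>
               (\<forall>col. cf_coloring F col \<longrightarrow> real (card (col ` F)) \<ge> c * ln (real n)))))"
proof (intro conjI)
  show "\<exists>C::real. \<forall>n::nat. n \<ge> 2 \<longrightarrow>
      (\<forall>F. finite F \<and> card F = n \<and> (\<forall>D\<in>F. is_disc D) \<longrightarrow>
        (\<exists>col. cf_coloring F col \<and> real (card (col ` F)) \<le> C * ln (real n)))"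
    using discs_cf_coloring_log by blast
  show "\<exists>c::real. c > 0 \<and> (\<forall>n::nat. n \<ge> 2 \<longrightarrow>
      (\<exists>F. finite F \<and> card F = n \<and> (\<forall>D\<in>F. is_disc D) \<and>
        (\<forall>col. cf_coloring F col \<longrightarrow> real (card (col ` F)) \<ge> c * ln (real n))))"
  proof (intro exI[of _ "1::real"] conjI allI impI)
    fix n :: nat assume n: "n \<ge> 2"
    let ?F = "(\<lambda>k. {complex_of_nat k}) ` {..<n}"
    have "card ?F = n"
      by (subst card_image) (auto simp: inj_on_def)
    moreover have "is_disc D" if D: "D \<in> ?F" for D
    proof -
      obtain k where "D = cball (complex_of_nat k) 0"
        using D by auto
      then show ?thesis
        unfolding is_disc_def by blast
    qed
    moreover have "1 * ln (real n) \<le> real (card (col ` ?F))" if "cf_coloring ?F col" for col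
      unfolding mult_1 by (rule collinear_points_lower_bound[OF _ refl that]) (use n in simp)
    ultimately show "\<exists>F. finite F \<and> card F = n \<and> (\<forall>D\<in>F. is_disc D) \<and>
        (\<forall>col. cf_coloring F col \<longrightarrow> real (card (col ` F)) \<ge> 1 * ln (real n))"
      by (intro exI[of _ ?F] conjI allI impI ballI finite_imageI finite_lessThan)
  qed simp
qed

end
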